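(* Let $G$ be a connected graph. Then the following hold: (1) $\gamma(S_2(G)) = |V_G|$. (2) $|V_G| \le \gamma_{\rm a}(S_2(G)) \le |V_G| + 2$. (3) $\gamma_{\rm a}(S_2(G)) = |V_G| + 2$ if $G$ is a cycle; $\gamma_{\rm a}(S_2(G)) = |V_G| + 1$ if $G = K_2$; and $\gamma_{\rm a}(S_2(G)) = |V_G|$ otherwise.
   Context: Graphs are finite, simple, undirected, with nonempty vertex set; $V_G$ and $E_G$ are the vertex and edge sets of $G$. A cycle is a graph $C_n$ with $n \ge 3$. A dominating set of $G$ is a set $D \subseteq V_G$ such that every vertex of $V_G \setminus D$ is adjacent to at least one vertex of $D$. The domination number $\gamma(G)$ is the minimum cardinality of a dominating set of $G$. An accurate dominating set of $G$ is a dominating set $D$ of $G$ such that no $|D|$-element subset of $V_G \setminus D$ is a dominating set of $G$; the accurate domination number $\gamma_{\rm a}(G)$ is the minimum cardinality of an accurate dominating set of $G$. The 2-subdivided graph $S_2(G)$ is the graph obtained from $G$ by subdividing every edge with two new vertices: its vertex set is $V_G \cup \bigcup_{vu \in E_G} \{(v,vu),(u,vu)\}$, where each $x \in V_G$ has neighborhood $\{(x,xy) \colon y \in N_G(x)\}$ and each new vertex $(x,xy)$ has neighborhood $\{x, (y,xy)\}$. That is, each edge $vu$ of $G$ is replaced by the path $v, (v,vu), (u,vu), u$. *)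

theory Defs
  imports
    "Graph_Theory.Pair_Digraph"
    "Graph_Theory.Digraph_Component"
    "Graph_Theory.Digraph_Isomorphism"
    "Graph_Theory.Kuratowski"
begin

text \<open>
  A finite simple undirected graph is a \<^locale>\<open>pair_graph\<close>: finite, loop-free, and with a symmetric
  arc relation, so that an edge \<open>vu\<close> corresponds to the two arcs \<open>(v, u)\<close> and \<open>(u, v)\<close>.
  Nonemptiness of the vertex set is part of \<^const>\<open>connected\<close>.
\<close>

definition cycle_graph :: "nat \<Rightarrow> nat pair_pre_digraph" where
  "cycle_graph n =
    \<lparr> pverts = {..<n},
      parcs = {(i, j). i < n \<and> j < n \<and> (j = Suc i mod n \<or> i = Suc j mod n)} \<rparr>"

definition is_cycle_graph :: "'a pair_pre_digraph \<Rightarrow> bool" where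
  "is_cycle_graph G \<longleftrightarrow> (\<exists>n\<ge>3. digraph_iso (with_proj G) (with_proj (cycle_graph n)))"

definition dominating_set :: "'a pair_pre_digraph \<Rightarrow> 'a set \<Rightarrow> bool" where
  "dominating_set G D \<longleftrightarrow>
    D \<subseteq> pverts G \<and> (\<forall>v \<in> pverts G - D. \<exists>u \<in> D. (v, u) \<in> parcs G)"

definition domination_number :: "'a pair_pre_digraph \<Rightarrow> nat" where
  "domination_number G = (LEAST k. \<exists>D. dominating_set G D \<and> card D = k)"

definition accurate_dominating_set :: "'a pair_pre_digraph \<Rightarrow> 'a set \<Rightarrow> bool" where
  "accurate_dominating_set G D \<longleftrightarrow>
    dominating_set G D \<and>
    \<not> (\<exists>D'. D' \<subseteq> pverts G - D \<and> card D' = card D \<and> dominating_set G D')"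

definition accurate_domination_number :: "'a pair_pre_digraph \<Rightarrow> nat" where
  "accurate_domination_number G = (LEAST k. \<exists>D. accurate_dominating_set G D \<and> card D = k)"

text \<open>\<open>Sub v {v, u}\<close> is the new vertex \<open>(v, vu)\<close>, the one adjacent to \<open>v\<close> on the subdivided edge \<open>vu\<close>.\<close>

datatype 'a subdiv_vertex = Orig 'a | Sub 'a "'a set"

definition subdivide2 :: "'a pair_pre_digraph \<Rightarrow> 'a subdiv_vertex pair_pre_digraph" where
  "subdivide2 G =
    \<lparr> pverts = Orig ` pverts G \<union> (\<Union>(v, u) \<in> parcs G. {Sub v {v, u}, Sub u {v, u}}),
      parcs = (\<Union>(v, u) \<in> parcs G.
        {(Orig v, Sub v {v, u}), (Sub v {v, u}, Orig v), (Sub v {v, u}, Sub u {v, u})}) \<rparr>"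

text \<open>Since both \<open>(v, u)\<close> and \<open>(u, v)\<close> are arcs of \<open>G\<close>, the arc relation above is symmetric.\<close>

lemma pair_graph_subdivide2:
  assumes "pair_graph G"
  shows "pair_graph (subdivide2 G)"
proof -
  interpret pair_graph G by fact
  have sym: "(u, v) \<in> parcs G" if "(v, u) \<in> parcs G" for v u
    using pair_sym_arcs that by (simp add: symmetric_def symD)
  show ?thesis
  proof
    show "finite (pverts (subdivide2 G))"
      using pair_finite_verts pair_finite_arcs by (simp add: subdivide2_def split_beta)
    show "finite (parcs (subdivide2 G))"
      using pair_finite_arcs by (simp add: subdivide2_def split_beta)
    show "symmetric (with_proj (subdivide2 G))"
      unfolding symmetric_def
    proof (rule symI)
      fix a b assume "(a, b) \<in> arcs_ends (with_proj (subdivide2 G))"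
      then obtain v u where vu: "(v, u) \<in> parcs G"
        and ab: "(a, b) \<in> {(Orig v, Sub v {v, u}), (Sub v {v, u}, Orig v), (Sub v {v, u}, Sub u {v, u})}"
        unfolding subdivide2_def with_proj_simps pair_pre_digraph.simps by blast
      have "\<exists>(v, u) \<in> parcs G.
          (b, a) \<in> {(Orig v, Sub v {v, u}), (Sub v {v, u}, Orig v), (Sub v {v, u}, Sub u {v, u})}"
      proof (cases "(a, b) = (Sub v {v, u}, Sub u {v, u})")
        case True
        then show ?thesis
          using sym[OF vu] by (intro bexI[of _ "(u, v)"]) (simp_all add: insert_commute)
      next
        case False
        then show ?thesis
          using ab vu by (intro bexI[of _ "(v, u)"]) auto
      qed
      then show "(b, a) \<in> arcs_ends (with_proj (subdivide2 G))"
        by (simp add: subdivide2_def split_beta)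
    qed
  next
    fix e assume "e \<in> parcs (subdivide2 G)"
    then obtain v u where vu: "(v, u) \<in> parcs G"
      and e: "e \<in> {(Orig v, Sub v {v, u}), (Sub v {v, u}, Orig v), (Sub v {v, u}, Sub u {v, u})}"
      unfolding subdivide2_def pair_pre_digraph.simps by blast
    have "Orig v \<in> pverts (subdivide2 G)"
      using in_arcsD1[OF vu] by (simp add: subdivide2_def)
    moreover have "{Sub v {v, u}, Sub u {v, u}} \<subseteq> pverts (subdivide2 G)"
      using vu unfolding subdivide2_def pair_pre_digraph.simps by blast
    moreover have "v \<noteq> u"
      using pair_no_loops[OF vu] by simp
    ultimately show "fst e \<in> pverts (subdivide2 G)" "snd e \<in> pverts (subdivide2 G)" "fst e \<noteq> snd e"
      using e by auto
  qed
qed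

end

theory Submission
  imports Defs
begin

text \<open>In \<open>S_2(G)\<close> the closed neighbourhoods of the original vertices partition
  the vertex set. A dominating set must dominate each original vertex, so it meets every class
  (\<open>center_dominating_set\<close>).

  For upper bounds on the accurate number, add to the original vertices all neighbours of one
  \<open>Orig v\<close>. A disjoint set cannot dominate \<open>Orig v\<close>, so the result is
  accurate, of size \<open>card (pverts G)\<close> plus the degree of \<open>v\<close>
  (\<open>accurate_star\<close>). Degree 2 serves for cycles and degree 1 for \<open>K_2\<close>.

  For the matching lower bound on a cycle, \<open>S_2(C_n)\<close> is the cycle
  \<open>C_{3n}\<close> (\<open>cyclic_enum_subdivide2\<close>), in which no set of size
  \<open>n\<close> or \<open>n + 1\<close> is accurate: a rotation of the set, or a residue class
  modulo 3, yields a dominating set of the same size in its complement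
  (\<open>cyclic_enum_not_accurate\<close>). For \<open>K_2\<close> the graph is a path on four
  vertices and complements do the same.

  In all other cases a suitable choice of one vertex per class is accurate. If it were not, a
  disjoint dominating set of the same size would also have one vertex per class. It would define a
  permutation of the vertices such that every edge joins a vertex to its image, which makes the
  connected graph \<open>G\<close> a cycle (\<open>accurate_or_cyclic\<close>,
  \<open>cyclic_enum_of_bij\<close>).\<close>

section \<open>Cyclic enumerations\<close>

text \<open>The enumeration is periodic on all of \<open>nat\<close>, so neighbours are reached by
  \<open>Suc\<close> with no reduction modulo \<open>n\<close> and windows may run past the end.
  Lengths 1 and 2 would describe a loop and a single edge, hence the separate condition
  \<open>n \<ge> 3\<close> wherever a genuine cycle is meant.\<close>

definition cyclic_enum :: "'a pair_pre_digraph \<Rightarrow> nat \<Rightarrow> (nat \<Rightarrow> 'a) \<Rightarrow> bool" where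
  "cyclic_enum G n p \<longleftrightarrow>
    bij_betw p {..<n} (pverts G) \<and> (\<forall>i. p (i + n) = p i) \<and>
    parcs G = (\<Union>i. {(p i, p (Suc i)), (p (Suc i), p i)})"

lemma periodic_mod:
  fixes p :: "nat \<Rightarrow> 'a"
  assumes "\<And>i. p (i + n) = p i"
  shows "p (i mod n) = p i"
proof -
  have "p (r + k * n) = p r" for r k
  proof (induction k)
    case (Suc k)
    have "p (r + Suc k * n) = p ((r + k * n) + n)" by (simp add: algebra_simps)
    then show ?case using assms Suc by simp
  qed simp
  from this[of "i mod n" "i div n"] show ?thesis by simp
qed

lemma
  assumes "cyclic_enum G n p"
  shows cyclic_enum_mod: "p (i mod n) = p i"
    and cyclic_enum_image: "p ` {..<n} = pverts G"
    and cyclic_enum_inj: "inj_on p {..<n}"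
    and cyclic_enum_card: "card (pverts G) = n"
proof -
  show "p (i mod n) = p i"
    using assms by (intro periodic_mod) (simp add: cyclic_enum_def)
  show "p ` {..<n} = pverts G" "inj_on p {..<n}"
    using assms by (auto simp: cyclic_enum_def bij_betw_def)
  then show "card (pverts G) = n" using card_image by fastforce
qed

lemma cyclic_enum_range:
  assumes "cyclic_enum G n p" "n > 0"
  shows "range p = pverts G"
proof -
  have "p i \<in> pverts G" for i
    using cyclic_enum_mod[OF assms(1), of i] cyclic_enum_image[OF assms(1)] assms(2)
    by (metis imageI lessThan_iff mod_less_divisor)
  then show ?thesis using cyclic_enum_image[OF assms(1)] by blast
qed

lemma cyclic_enum_eq_iff:
  assumes "cyclic_enum G n p" "n > 0"
  shows "p i = p j \<longleftrightarrow> i mod n = j mod n"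
proof -
  have "p (i mod n) = p (j mod n) \<longleftrightarrow> i mod n = j mod n"
    using inj_on_eq_iff[OF cyclic_enum_inj[OF assms(1)]] assms(2) by simp
  then show ?thesis by (simp add: cyclic_enum_mod[OF assms(1)])
qed

lemma cyclic_enum_Suc_eq_iff:
  assumes "cyclic_enum G n p" "n > 0"
  shows "p (Suc i) = p (Suc j) \<longleftrightarrow> p i = p j"
  unfolding cyclic_enum_eq_iff[OF assms]
  by (auto simp: mod_Suc split: if_splits)

text \<open>Rotational symmetry: an argument on a cycle may start counting at any vertex.\<close>

lemma cyclic_enum_shift:
  assumes "cyclic_enum G n p" "n > 0"
  shows "cyclic_enum G n (\<lambda>i. p (i + k))"
proof -
  have per: "p (i + n) = p i" for i
    using assms by (simp add: cyclic_enum_def)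
  \<comment> \<open>\<open>n - k mod n\<close> stands in for \<open>-k\<close>: adding it and then
    \<open>k\<close> advances by a multiple of \<open>n\<close>.\<close>
  have *: "p ((i + (n - k mod n)) + k) = p i" for i
  proof -
    have "k mod n < n" using assms(2) by simp
    then have "i + (n - k mod n) + k = i + (k div n + 1) * n"
      using div_mult_mod_eq[of k n] unfolding distrib_right by linarith
    then have "(i + (n - k mod n) + k) mod n = i mod n"
      by (metis mod_mult_self1)
    then show ?thesis using cyclic_enum_eq_iff[OF assms] by blast
  qed
  have inj: "inj_on (\<lambda>i. p (i + k)) {..<n}"
  proof (rule inj_onI)
    fix i j assume ij: "i \<in> {..<n}" "j \<in> {..<n}" "p (i + k) = p (j + k)"
    have "p (i + k) = p (j + k) \<longleftrightarrow> p i = p j" for i j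
      by (induction k) (simp_all add: cyclic_enum_Suc_eq_iff[OF assms])
    then show "i = j" using ij cyclic_enum_inj[OF assms(1)] by (auto dest: inj_onD)
  qed
  have "(\<lambda>i. p (i + k)) ` {..<n} \<subseteq> pverts G"
    using cyclic_enum_range[OF assms] by blast
  moreover have "finite (pverts G)"
    using cyclic_enum_image[OF assms(1)] by (metis finite_imageI finite_lessThan)
  ultimately have "(\<lambda>i. p (i + k)) ` {..<n} = pverts G"
    using card_image[OF inj] cyclic_enum_card[OF assms(1)] by (simp add: card_subset_eq)
  moreover have "(\<Union>i. {(p i, p (Suc i)), (p (Suc i), p i)}) =
      (\<Union>i. {(p (i + k), p (Suc i + k)), (p (Suc i + k), p (i + k))})" (is "?L = ?R")
  proof
    show "?R \<subseteq> ?L" by auto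
    have "\<exists>j. p (j + k) = p i \<and> p (Suc j + k) = p (Suc i)" for i
      using *[of i] cyclic_enum_Suc_eq_iff[OF assms] by (metis add_Suc)
    then have "{(p i, p (Suc i)), (p (Suc i), p i)} \<subseteq> ?R" for i
      by (metis (mono_tags, lifting) UNIV_I UN_upper)
    then show "?L \<subseteq> ?R" by blast
  qed
  moreover have "p (i + n + k) = p (i + k)" for i
    using per[of "i + k"] by (simp add: ac_simps)
  ultimately show ?thesis
    using assms(1) inj by (simp add: cyclic_enum_def bij_betw_def)
qed

text \<open>Trades the isomorphism with \<open>cycle_graph n\<close> for an enumeration of the
  vertices of \<open>G\<close> itself, on which all later cycle arguments run.\<close>

lemma is_cycle_graph_iff_cyclic_enum:
  assumes "pair_graph G"
  shows "is_cycle_graph G \<longleftrightarrow> (\<exists>n\<ge>3. \<exists>p. cyclic_enum G n p)"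
proof
  interpret pair_graph G by fact
  assume "is_cycle_graph G"
  then obtain n hom where n: "n \<ge> 3" and hom: "digraph_isomorphism hom"
    and eq: "with_proj (cycle_graph n) = app_iso hom (with_proj G)"
    unfolding is_cycle_graph_def digraph_iso_def by blast
  define f where "f = iso_verts hom"
  have inj: "inj_on f (pverts G)"
    using digraph_isomorphism_inj_on_verts[OF hom] by (simp add: f_def)
  have im: "f ` pverts G = {..<n}"
    using arg_cong[OF eq, of verts] by (simp add: cycle_graph_def f_def)
  have arcs: "{(i, j). i < n \<and> j < n \<and> (j = Suc i mod n \<or> i = Suc j mod n)} = map_prod f f ` parcs G"
    using arg_cong[OF eq, of arcs_ends] arcs_ends_app_iso_eq[OF hom]
    by (simp add: cycle_graph_def f_def map_prod_def)
  define q where "q = inv_into (pverts G) f"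
  have q: "bij_betw q {..<n} (pverts G)"
    unfolding q_def by (rule bij_betw_inv_into) (simp add: bij_betw_def inj im)
  have fq: "f (q i) = i" if "i < n" for i
    using that im by (simp add: q_def f_inv_into_f)
  have qf: "q (f v) = v" if "v \<in> pverts G" for v
    using that inj by (simp add: q_def)
  have parcs: "parcs G = map_prod q q ` {(i, j). i < n \<and> j < n \<and> (j = Suc i mod n \<or> i = Suc j mod n)}"
  proof -
    have "map_prod q q ` map_prod f f ` parcs G = (\<lambda>e. e) ` parcs G"
      unfolding image_image
      by (intro image_cong) (auto intro!: qf dest: in_arcsD1 in_arcsD2)
    then show ?thesis by (simp add: arcs)
  qed
  have "cyclic_enum G n (\<lambda>i. q (i mod n))"
    unfolding cyclic_enum_def
  proof (intro conjI allI)
    show "bij_betw (\<lambda>i. q (i mod n)) {..<n} (pverts G)"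
      using q by (subst bij_betw_cong[of _ _ q]) auto
    show "q ((i + n) mod n) = q (i mod n)" for i by simp
    show "parcs G = (\<Union>i. {(q (i mod n), q (Suc i mod n)), (q (Suc i mod n), q (i mod n))})" (is "_ = ?R")
    proof
      show "parcs G \<subseteq> ?R"
        unfolding parcs by (force simp: mod_less)
      have "(q (i mod n), q (Suc i mod n)) \<in> parcs G \<and> (q (Suc i mod n), q (i mod n)) \<in> parcs G" for i
        unfolding parcs using n
        using image_eqI[of "(q (i mod n), q (Suc i mod n))" "map_prod q q" "(i mod n, Suc i mod n)"]
          image_eqI[of "(q (Suc i mod n), q (i mod n))" "map_prod q q" "(Suc i mod n, i mod n)"]
        by (simp add: mod_Suc_eq)
      then show "?R \<subseteq> parcs G" by blast
    qed
  qed
  then show "\<exists>n\<ge>3. \<exists>p. cyclic_enum G n p" using n by blast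
next
  interpret pair_graph G by fact
  assume "\<exists>n\<ge>3. \<exists>p. cyclic_enum G n p"
  then obtain n p where n: "n \<ge> 3" and p: "cyclic_enum G n p" by blast
  have n0: "n > 0" using n by simp
  define f where "f = inv_into {..<n} p"
  have fp: "f (p i) = i mod n" for i
    using inv_into_f_f[OF cyclic_enum_inj[OF p], of "i mod n"] n0
    by (simp add: f_def cyclic_enum_mod[OF p])
  have bij: "bij_betw f (pverts G) {..<n}"
    unfolding f_def using p by (intro bij_betw_inv_into) (simp add: cyclic_enum_def)
  have parcs: "parcs G = (\<Union>i. {(p i, p (Suc i)), (p (Suc i), p i)})"
    using p by (simp add: cyclic_enum_def)
  define hom where "hom = \<lparr> iso_verts = f, iso_arcs = map_prod f f, iso_head = snd, iso_tail = fst \<rparr>"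
  have "inj_on (map_prod f f) (parcs G)"
    by (rule inj_on_subset[OF map_prod_inj_on[OF bij_betw_imp_inj_on[OF bij] bij_betw_imp_inj_on[OF bij]]])
      (auto dest: in_arcsD1 in_arcsD2)
  then have iso: "digraph_isomorphism hom"
    unfolding digraph_isomorphism_def
    using bij wf_digraph_axioms by (auto simp: hom_def bij_betw_def)
  have "map_prod f f ` parcs G = {(i, j). i < n \<and> j < n \<and> (j = Suc i mod n \<or> i = Suc j mod n)}" (is "_ = ?R")
  proof
    show "map_prod f f ` parcs G \<subseteq> ?R"
      unfolding parcs using n0 by (auto simp: fp mod_Suc_eq)
    show "?R \<subseteq> map_prod f f ` parcs G"
    proof clarify
      fix i j assume *: "i < n" "j < n" "j = Suc i mod n \<or> i = Suc j mod n"
      show "(i, j) \<in> map_prod f f ` parcs G"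
      proof (cases "j = Suc i mod n")
        case True
        then have "(i, j) = map_prod f f (p i, p (Suc i))" using * by (simp add: fp)
        then show ?thesis unfolding parcs by blast
      next
        case False
        then have "(i, j) = map_prod f f (p (Suc j), p j)" using * by (simp add: fp)
        then show ?thesis unfolding parcs by blast
      qed
    qed
  qed
  then have "with_proj (cycle_graph n) = app_iso hom (with_proj G)"
    using bij by (simp add: app_iso_def hom_def with_proj_def cycle_graph_def bij_betw_def)
  then show "is_cycle_graph G"
    unfolding is_cycle_graph_def digraph_iso_def using n iso by blast
qed

section \<open>Dominating sets of cycles whose length is a multiple of three\<close>

lemma dominating_set_mono:
  "dominating_set G D \<Longrightarrow> D \<subseteq> D' \<Longrightarrow> D' \<subseteq> pverts G \<Longrightarrow> dominating_set G D'"
  unfolding dominating_set_def by blast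

text \<open>The closed neighbourhood of \<open>p (Suc i)\<close> is a window of three consecutive
  vertices, and by periodicity every vertex is the middle of such a window.\<close>

lemma cyclic_enum_dominating_set_iff:
  assumes p: "cyclic_enum G n p" "n > 0"
  shows "dominating_set G D \<longleftrightarrow>
    D \<subseteq> pverts G \<and> (\<forall>i. p i \<in> D \<or> p (Suc i) \<in> D \<or> p (Suc (Suc i)) \<in> D)"
proof -
  have nbr: "(p (Suc i), y) \<in> parcs G \<longleftrightarrow> y = p i \<or> y = p (Suc (Suc i))" for i y
    using p(1) cyclic_enum_Suc_eq_iff[OF p] unfolding cyclic_enum_def by auto
  have "\<exists>i. v = p (Suc i)" if "v \<in> pverts G" for v
  proof -
    from that obtain j where "v = p j" using cyclic_enum_range[OF p] by blast
    then have "v = p (Suc (j + n - 1))"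
      using p by (simp add: cyclic_enum_def)
    then show ?thesis by blast
  qed
  moreover have "p i \<in> pverts G" for i using cyclic_enum_range[OF p] by blast
  ultimately have "(\<forall>v \<in> pverts G - D. \<exists>u \<in> D. (v, u) \<in> parcs G) \<longleftrightarrow>
      (\<forall>i. p (Suc i) \<in> D \<or> (\<exists>u \<in> D. (p (Suc i), u) \<in> parcs G))"
    by blast
  then show ?thesis unfolding dominating_set_def nbr by blast
qed

text \<open>A set without two consecutive vertices is disjoint from its shift. Otherwise, starting the
  enumeration at two consecutive vertices of the set, the residue class of 2 modulo 3 avoids the
  set: a further member there would require \<open>n + 2\<close> vertices.\<close>

lemma cyclic_enum_not_accurate:
  assumes p: "cyclic_enum G (3 * n) p" and n: "n \<ge> 2"
    and D: "n \<le> card D" "card D \<le> n + 1"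
  shows "\<not> accurate_dominating_set G D"
proof
  assume acc: "accurate_dominating_set G D"
  have n3: "3 * n > 0" using n by simp
  have sub: "D \<subseteq> pverts G" and dom: "dominating_set G D"
    using acc by (auto simp: accurate_dominating_set_def dominating_set_def)
  have no: False if "D' \<subseteq> pverts G - D" "card D' = card D" "dominating_set G D'" for D'
    using acc that by (auto simp: accurate_dominating_set_def)
  have fin: "finite (pverts G)"
    using cyclic_enum_image[OF p] by (metis finite_imageI finite_lessThan)
  have inV: "p i \<in> pverts G" for i using cyclic_enum_range[OF p n3] by blast
  show False
  proof (cases "\<exists>x. p x \<in> D \<and> p (Suc x) \<in> D")
    \<comment> \<open>With no two consecutive members, rotating the set by one step moves it off
      itself and keeps size and domination.\<close>
    case False
    define I where "I = {i. i < 3 * n \<and> p i \<in> D}"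
    have DI: "D = p ` I"
      using sub cyclic_enum_image[OF p] by (auto simp: I_def)
    have injI: "inj_on p I"
      by (rule inj_on_subset[OF cyclic_enum_inj[OF p]]) (auto simp: I_def)
    have "inj_on (\<lambda>i. p (Suc i)) I"
      using injI by (simp add: inj_on_def cyclic_enum_Suc_eq_iff[OF p n3])
    then have "card ((\<lambda>i. p (Suc i)) ` I) = card D"
      using injI DI by (simp add: card_image)
    moreover have "(\<lambda>i. p (Suc i)) ` I \<subseteq> pverts G - D"
      using False inV by (auto simp: I_def)
    moreover have "dominating_set G ((\<lambda>i. p (Suc i)) ` I)"
    proof -
      have shift: "p (Suc i) \<in> (\<lambda>i. p (Suc i)) ` I" if "p i \<in> D" for i
        using that DI cyclic_enum_Suc_eq_iff[OF p n3] by (metis (no_types, lifting) image_iff)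
      have wrap: "\<exists>j. p (Suc j) = p i" for i
        using p n3 by (intro exI[of _ "i + 3 * n - 1"]) (simp add: cyclic_enum_def)
      show ?thesis
        unfolding cyclic_enum_dominating_set_iff[OF p n3]
      proof (intro conjI allI)
        show "(\<lambda>i. p (Suc i)) ` I \<subseteq> pverts G" using inV by auto
        fix i
        obtain j where j: "p (Suc j) = p i" using wrap by blast
        have "p j \<in> D \<or> p (Suc j) \<in> D \<or> p (Suc (Suc j)) \<in> D"
          using dom unfolding cyclic_enum_dominating_set_iff[OF p n3] by blast
        then show "p i \<in> (\<lambda>i. p (Suc i)) ` I \<or> p (Suc i) \<in> (\<lambda>i. p (Suc i)) ` I \<or>
            p (Suc (Suc i)) \<in> (\<lambda>i. p (Suc i)) ` I"
          using shift j cyclic_enum_Suc_eq_iff[OF p n3] by metis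
      qed
    qed
    ultimately show False using no by blast
  next
    case True
    then obtain x where x: "p x \<in> D" "p (Suc x) \<in> D" by blast
    define q where "q = (\<lambda>i. p (i + x))"
    have q: "cyclic_enum G (3 * n) q"
      unfolding q_def by (rule cyclic_enum_shift[OF p n3])
    have q01: "q 0 \<in> D" "q 1 \<in> D" using x by (simp_all add: q_def)
    have win: "q i \<in> D \<or> q (Suc i) \<in> D \<or> q (Suc (Suc i)) \<in> D" for i
      using dom unfolding cyclic_enum_dominating_set_iff[OF q n3] by blast
    define I where "I = {i. i < 3 * n \<and> q i \<in> D}"
    have DI: "D = q ` I"
      using sub cyclic_enum_image[OF q] by (auto simp: I_def)
    have "inj_on q I"
      by (rule inj_on_subset[OF cyclic_enum_inj[OF q]]) (auto simp: I_def)
    then have cardI: "card I = card D" using DI by (simp add: card_image)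
    have avoid: "q (3 * k + 2) \<notin> D" if k: "k < n" for k
    proof
      assume kD: "q (3 * k + 2) \<in> D"
      \<comment> \<open>\<open>h\<close> numbers the blocks \<open>{0}\<close>, \<open>{1}\<close>, \<open>{2, 3, 4}\<close>, \<open>\<dots>\<close>, \<open>{3k - 1, 3k, 3k + 1}\<close>, \<open>{3k + 2}\<close>,
        \<open>{3k + 3, 3k + 4, 3k + 5}\<close>, \<open>\<dots>\<close>, each of which meets the set.\<close>
      define h where "h i = (if i = 0 then 0 else if i \<le> 3 * k + 1 then (i + 4) div 3
        else if i = 3 * k + 2 then k + 2 else i div 3 + 2)" for i
      have "\<exists>i\<in>I. h i = t" if t: "t < n + 2" for t
      proof -
        consider "t = 0" | "t = 1" | "2 \<le> t" "t \<le> k + 1" | "t = k + 2" | "k + 3 \<le> t" by linarith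
        then show ?thesis
        proof cases
          case 1 then show ?thesis using q01 n by (intro bexI[of _ 0]) (auto simp: h_def I_def)
        next
          case 2 then show ?thesis using q01 n by (intro bexI[of _ 1]) (auto simp: h_def I_def)
        next
          case 3
          then obtain s where s: "t = s + 2" "s < k" using that[of "t - 2"] by simp
          have "h (3 * s + 2) = t" "h (Suc (3 * s + 2)) = t" "h (Suc (Suc (3 * s + 2))) = t"
            using s by (auto simp: h_def)
          moreover have "3 * s + 4 < 3 * n" using s k by linarith
          ultimately show ?thesis using win[of "3 * s + 2"] unfolding I_def by fastforce
        next
          case 4 then show ?thesis using kD k by (intro bexI[of _ "3 * k + 2"]) (auto simp: h_def I_def)
        next
          case 5
          then obtain s where s: "t = s + 2" "s > k" using that[of "t - 2"] by simp
          have "h (3 * s) = t" "h (Suc (3 * s)) = t" "h (Suc (Suc (3 * s))) = t"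
            using s by (auto simp: h_def)
          moreover have "3 * s + 2 < 3 * n" using s t by linarith
          ultimately show ?thesis using win[of "3 * s"] unfolding I_def by fastforce
        qed
      qed
      \<comment> \<open>The blocks are two singletons, \<open>k\<close> windows, another singleton
        and \<open>n - 1 - k\<close> windows. Each contains a member of the set, so there are at
        least \<open>n + 2\<close> members.\<close>
      then have "{..<n + 2} \<subseteq> h ` I" by (auto simp: image_iff)
      then have "n + 2 \<le> card I"
        using surj_card_le[of I "{..<n + 2}" h] by (simp add: I_def)
      then show False using cardI D(2) by simp
    qed
    \<comment> \<open>Every third vertex of the cycle: each window of three meets this class, so it
      already dominates.\<close>
    define R where "R = (\<lambda>k. q (3 * k + 2)) ` {..<n}"
    have RD: "R \<subseteq> pverts G - D"
      using avoid cyclic_enum_range[OF q n3] by (auto simp: R_def)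
    have "card R \<le> card D"
      using card_image_le[of "{..<n}" "\<lambda>k. q (3 * k + 2)"] D(1) by (simp add: R_def)
    moreover have "card D \<le> card (pverts G - D)"
      using D(2) n sub cyclic_enum_card[OF p] fin
      by (simp add: card_Diff_subset finite_subset)
    \<comment> \<open>\<open>R\<close> has at most \<open>n\<close> elements while \<open>D\<close>
      may have \<open>n + 1\<close>, so \<open>R\<close> is padded inside the complement. There is
      room, because \<open>3 * n - (n + 1) \<ge> n + 1\<close> for \<open>n \<ge> 2\<close>.\<close>
    ultimately obtain D' where D': "R \<subseteq> D'" "D' \<subseteq> pverts G - D" "card D' = card D"
      using exists_subset_between[of R "card D" "pverts G - D"] RD fin by blast
    have "dominating_set G R"
      unfolding cyclic_enum_dominating_set_iff[OF q n3]
    proof (intro conjI allI)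
      show "R \<subseteq> pverts G" using RD by blast
      \<comment> \<open>Residues modulo 3 are well defined on the cycle because 3 divides its
        length.\<close>
      fix i
      have R: "q j \<in> R" if "j mod 3 = 2" for j
      proof -
        have "j mod (3 * n) mod 3 = 2" using that by (simp add: mod_mod_cancel)
        then obtain m where m: "j mod (3 * n) = 3 * m + 2"
          by (metis mult_div_mod_eq)
        then have "m < n"
          using mod_less_divisor[OF n3, of j] by simp
        moreover have "q j = q (3 * m + 2)"
          unfolding m[symmetric] by (simp only: cyclic_enum_mod[OF q])
        ultimately show ?thesis by (auto simp: R_def)
      qed
      have "i mod 3 = 2 \<or> Suc i mod 3 = 2 \<or> Suc (Suc i) mod 3 = 2" by presburger
      then show "q i \<in> R \<or> q (Suc i) \<in> R \<or> q (Suc (Suc i)) \<in> R" using R by blast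
    qed
    then have "dominating_set G D'" using D' by (blast intro: dominating_set_mono)
    then show False using no D' by blast
  qed
qed

section \<open>The 2-subdivided graph\<close>

lemma subdivide2_verts [simp]:
  "Orig v \<in> pverts (subdivide2 G) \<longleftrightarrow> v \<in> pverts G"
  "Sub v e \<in> pverts (subdivide2 G) \<longleftrightarrow>
    (\<exists>u. ((v, u) \<in> parcs G \<or> (u, v) \<in> parcs G) \<and> e = {v, u})"
  by (auto simp: subdivide2_def insert_commute)

lemma subdivide2_arcs_Orig [simp]:
  "(Orig v, y) \<in> parcs (subdivide2 G) \<longleftrightarrow> (\<exists>u. (v, u) \<in> parcs G \<and> y = Sub v {v, u})"
  by (auto simp: subdivide2_def)

lemma subdivide2_arcs_Sub [simp]:
  "(Sub v e, y) \<in> parcs (subdivide2 G) \<longleftrightarrow>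
    (\<exists>u. (v, u) \<in> parcs G \<and> e = {v, u} \<and> (y = Orig v \<or> y = Sub u e))"
  by (auto simp: subdivide2_def)

text \<open>Going once around \<open>G\<close>, each step along an edge passes its two new vertices,
  so every index of \<open>p\<close> expands to three indices of \<open>q\<close>.\<close>

lemma cyclic_enum_subdivide2:
  assumes p: "cyclic_enum G n p" and n: "n \<ge> 3"
  shows "\<exists>q. cyclic_enum (subdivide2 G) (3 * n) q"
proof -
  have n0: "n > 0" using n by simp
  have parcs: "parcs G = (\<Union>i. {(p i, p (Suc i)), (p (Suc i), p i)})"
    and per: "p (i + n) = p i" for i
    using p by (simp_all add: cyclic_enum_def)
  define q where "q i = (let j = i div 3 in if i mod 3 = 0 then Orig (p j)
    else if i mod 3 = 1 then Sub (p j) {p j, p (Suc j)} else Sub (p (Suc j)) {p j, p (Suc j)})" for i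
  have q: "q (3 * j) = Orig (p j)" "q (3 * j + 1) = Sub (p j) {p j, p (Suc j)}"
    "q (3 * j + 2) = Sub (p (Suc j)) {p j, p (Suc j)}" for j
  proof -
    have "(3 * j + 1) div 3 = j" "(3 * j + 1) mod 3 = 1" "(3 * j + 2) div 3 = j" "(3 * j + 2) mod 3 = 2"
      by presburger+
    then show "q (3 * j) = Orig (p j)" "q (3 * j + 1) = Sub (p j) {p j, p (Suc j)}"
      "q (3 * j + 2) = Sub (p (Suc j)) {p j, p (Suc j)}"
      by (simp_all only: q_def Let_def) simp_all
  qed
  have q_Suc: "q (Suc (3 * j)) = Sub (p j) {p j, p (Suc j)}"
    "q (Suc (Suc (3 * j))) = Sub (p (Suc j)) {p j, p (Suc j)}"
    "q (Suc (Suc (Suc (3 * j)))) = Orig (p (Suc j))" for j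
  proof -
    have "Suc (Suc (Suc (3 * j))) = 3 * Suc j" by simp
    then show "q (Suc (Suc (Suc (3 * j)))) = Orig (p (Suc j))" by (simp only: q(1))
  qed (use q(2,3)[of j] in simp_all)
  have cases3: "\<exists>j. i = 3 * j \<or> i = 3 * j + 1 \<or> i = 3 * j + 2" for i :: nat
    by presburger
  have qper: "q (i + 3 * n) = q i" for i
  proof -
    have "(i + 3 * n) div 3 = i div 3 + n" "(i + 3 * n) mod 3 = i mod 3" by simp_all
    then show ?thesis unfolding q_def Let_def using per[of "i div 3"] per[of "Suc (i div 3)"] by (simp add: add.commute)
  qed
  have inj: "inj_on q {..<3 * n}"
  proof (rule inj_onI)
    fix a b assume ab: "a \<in> {..<3 * n}" "b \<in> {..<3 * n}" "q a = q b"
    have eqD: "i = j" if "p i = p j" "i < n" "j < n" for i j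
      using that cyclic_enum_eq_iff[OF p n0] by simp
    \<comment> \<open>An edge determines its position on the cycle. If two positions gave the same
      edge in opposite directions, \<open>p\<close> would repeat after two steps, which
      \<open>n \<ge> 3\<close> excludes.\<close>
    have twist: False if "p i = p (Suc j)" "p (Suc i) = p j" for i j
    proof -
      have "p (Suc (Suc j)) = p j"
        using that cyclic_enum_Suc_eq_iff[OF p n0] by metis
      then have "(j + 2) mod n = j mod n"
        using cyclic_enum_eq_iff[OF p n0] by simp
      then have "n dvd 2"
        using mod_eq_dvd_iff_nat[of j "j + 2" n] by simp
      then show False using n by (auto dest: dvd_imp_le)
    qed
    obtain i where i: "a = 3 * i \<or> a = 3 * i + 1 \<or> a = 3 * i + 2" using cases3 by blast
    obtain j where j: "b = 3 * j \<or> b = 3 * j + 1 \<or> b = 3 * j + 2" using cases3 by blast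
    have "i < n" "j < n" using ab i j by auto
    moreover have "p i = p j"
      using i j ab(3) twist[of i j] twist[of j i]
      by (auto simp: q_Suc q doubleton_eq_iff cyclic_enum_Suc_eq_iff[OF p n0])
    ultimately have "i = j" using eqD by blast
    moreover have "p i \<noteq> p (Suc i)"
      using twist[of i i] by auto
    ultimately show "a = b" using i j ab(3) by (auto simp: q_Suc q)
  qed
  have qi: "q i \<in> q ` {..<3 * n}" for i
    using periodic_mod[of q "3 * n" i, OF qper] n0
    by (metis imageI lessThan_iff mod_less_divisor mult_pos_pos zero_less_numeral)
  have range: "range q = pverts (subdivide2 G)"
  proof
    show "range q \<subseteq> pverts (subdivide2 G)"
    proof clarify
      fix i :: nat
      obtain j where j: "i = 3 * j \<or> i = 3 * j + 1 \<or> i = 3 * j + 2" using cases3 by blast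
      have "p j \<in> pverts G" using cyclic_enum_range[OF p n0] by blast
      moreover have "(p j, p (Suc j)) \<in> parcs G" using parcs by blast
      ultimately show "q i \<in> pverts (subdivide2 G)"
        using j by (auto simp: q_Suc q insert_commute)
    qed
    show "pverts (subdivide2 G) \<subseteq> range q"
    proof
      fix x assume x: "x \<in> pverts (subdivide2 G)"
      show "x \<in> range q"
      proof (cases x)
        case (Orig v)
        then obtain j where "v = p j" using x cyclic_enum_range[OF p n0] by auto
        then show ?thesis using q(1) Orig by (metis rangeI)
      next
        case (Sub v e)
        then obtain u where "(v, u) \<in> parcs G \<or> (u, v) \<in> parcs G" "e = {v, u}" using x by auto
        then obtain j where "v = p j \<and> e = {p j, p (Suc j)} \<or> v = p (Suc j) \<and> e = {p j, p (Suc j)}"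
          unfolding parcs by (auto simp: insert_commute)
        then show ?thesis using q(2,3) Sub by (metis rangeI)
      qed
    qed
  qed
  have "range q = q ` {..<3 * n}"
    by (rule equalityI[OF image_subsetI[OF qi] image_mono]) simp
  with range have "q ` {..<3 * n} = pverts (subdivide2 G)" by simp
  moreover have "parcs (subdivide2 G) = (\<Union>i. {(q i, q (Suc i)), (q (Suc i), q i)})" (is "_ = ?R")
  proof
    show "?R \<subseteq> parcs (subdivide2 G)"
    proof -
      have "(q i, q (Suc i)) \<in> parcs (subdivide2 G) \<and> (q (Suc i), q i) \<in> parcs (subdivide2 G)" for i
      proof -
        obtain j where j: "i = 3 * j \<or> i = 3 * j + 1 \<or> i = 3 * j + 2" using cases3 by blast
        have "(p j, p (Suc j)) \<in> parcs G" "(p (Suc j), p j) \<in> parcs G" using parcs by blast+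
        then show ?thesis using j by (auto simp: q_Suc q insert_commute)
      qed
      then show ?thesis by blast
    qed
    have R: "(q i, q (Suc i)) \<in> ?R" "(q (Suc i), q i) \<in> ?R" for i by blast+
    have R3: "(Orig (p j), Sub (p j) {p j, p (Suc j)}) \<in> ?R"
      "(Sub (p j) {p j, p (Suc j)}, Orig (p j)) \<in> ?R"
      "(Sub (p j) {p j, p (Suc j)}, Sub (p (Suc j)) {p j, p (Suc j)}) \<in> ?R"
      "(Sub (p (Suc j)) {p j, p (Suc j)}, Sub (p j) {p j, p (Suc j)}) \<in> ?R"
      "(Sub (p (Suc j)) {p j, p (Suc j)}, Orig (p (Suc j))) \<in> ?R"
      "(Orig (p (Suc j)), Sub (p (Suc j)) {p j, p (Suc j)}) \<in> ?R" for j
      using R[of "3 * j"] R[of "Suc (3 * j)"] R[of "Suc (Suc (3 * j))"]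
      unfolding q(1) q_Suc by blast+
    show "parcs (subdivide2 G) \<subseteq> ?R"
    proof
      fix e assume "e \<in> parcs (subdivide2 G)"
      then obtain v u where vu: "(v, u) \<in> parcs G"
        and e: "e \<in> {(Orig v, Sub v {v, u}), (Sub v {v, u}, Orig v), (Sub v {v, u}, Sub u {v, u})}"
        unfolding subdivide2_def pair_pre_digraph.simps by blast
      from vu obtain j where "v = p j \<and> u = p (Suc j) \<or> v = p (Suc j) \<and> u = p j"
        unfolding parcs by auto
      then have "v = p j \<and> u = p (Suc j) \<or> v = p (Suc j) \<and> u = p j \<and> {v, u} = {p j, p (Suc j)}"
        by (auto simp: insert_commute)
      then show "e \<in> ?R"
        using e R3[of j] by (elim disjE conjE) (simp_all del: UN_iff, blast+)
    qed
  qed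
  ultimately have "cyclic_enum (subdivide2 G) (3 * n) q"
    using inj qper by (simp add: cyclic_enum_def bij_betw_def)
  then show ?thesis by blast
qed

text \<open>The closed neighbourhoods of the original vertices partition the vertices of the subdivided
  graph; \<open>center\<close> maps a vertex to the class containing it.\<close>

primrec center :: "'a subdiv_vertex \<Rightarrow> 'a" where
  "center (Orig v) = v"
| "center (Sub v e) = v"

lemma LEAST_card_eqI:
  assumes "P D" "\<And>D'. P D' \<Longrightarrow> card D \<le> card D'"
  shows "(LEAST k. \<exists>D. P D \<and> card D = k) = card D"
  using assms by (intro Least_equality) auto

context pair_graph
begin

section \<open>Lower bound from the classes, upper bound from stars\<close>

lemma arc_sym: "(u, v) \<in> parcs G \<Longrightarrow> (v, u) \<in> parcs G"
  using pair_sym_arcs by (simp add: symmetric_def symD)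

lemma finite_subdivide2: "finite (pverts (subdivide2 G))"
  using pair_graph_subdivide2[OF pair_graph_axioms]
  by (simp add: pair_graph_def pair_pseudo_graph_def pair_fin_digraph_def pair_fin_digraph_axioms_def)

lemma center_verts: "x \<in> pverts (subdivide2 G) \<Longrightarrow> center x \<in> pverts G"
  by (cases x) (auto dest: in_arcsD1 in_arcsD2)

text \<open>All neighbours of \<open>Orig v\<close> lie in the class of \<open>v\<close>, so
  \<open>Orig v\<close> can only be dominated from within that class.\<close>

lemma center_dominating_set:
  assumes "dominating_set (subdivide2 G) D"
  shows "center ` D = pverts G"
proof
  show "center ` D \<subseteq> pverts G"
    using assms center_verts by (auto simp: dominating_set_def)
  show "pverts G \<subseteq> center ` D"
  proof
    fix v assume "v \<in> pverts G"
    then have "Orig v \<in> D \<or> (\<exists>y\<in>D. (Orig v, y) \<in> parcs (subdivide2 G))"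
      using assms by (auto simp: dominating_set_def simp del: subdivide2_arcs_Orig)
    then show "v \<in> center ` D" by (force simp: image_iff)
  qed
qed

lemma card_dominating_set_ge:
  assumes "dominating_set (subdivide2 G) D"
  shows "card (pverts G) \<le> card D"
proof -
  have "finite D"
    using assms finite_subdivide2 by (auto simp: dominating_set_def intro: finite_subset)
  then show ?thesis
    using center_dominating_set[OF assms] card_image_le by metis
qed

lemma dominating_set_Orig: "dominating_set (subdivide2 G) (Orig ` pverts G)"
  unfolding dominating_set_def
proof (intro conjI ballI)
  fix x assume "x \<in> pverts (subdivide2 G) - Orig ` pverts G"
  then show "\<exists>y\<in>Orig ` pverts G. (x, y) \<in> parcs (subdivide2 G)"
    by (cases x) (auto dest: arc_sym in_arcsD1 in_arcsD2)
qed auto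

lemma card_Orig: "card (Orig ` A) = card A"
  by (simp add: card_image inj_on_def)

lemma domination_number_subdivide2: "domination_number (subdivide2 G) = card (pverts G)"
  unfolding domination_number_def
  using LEAST_card_eqI[of "dominating_set (subdivide2 G)", OF dominating_set_Orig]
    card_dominating_set_ge by (simp add: card_Orig)

text \<open>The set contains the whole closed neighbourhood of \<open>Orig v\<close>, which leaves a
  disjoint set nothing to dominate \<open>Orig v\<close> with.\<close>

lemma accurate_star:
  assumes "v \<in> pverts G"
  shows "accurate_dominating_set (subdivide2 G)
    (Orig ` pverts G \<union> (\<lambda>u. Sub v {v, u}) ` {u. (v, u) \<in> parcs G})" (is "accurate_dominating_set _ ?D")
  unfolding accurate_dominating_set_def
proof (intro conjI notI)
  show "dominating_set (subdivide2 G) ?D"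
    by (rule dominating_set_mono[OF dominating_set_Orig]) auto
  assume "\<exists>D'. D' \<subseteq> pverts (subdivide2 G) - ?D \<and> card D' = card ?D \<and> dominating_set (subdivide2 G) D'"
  then obtain D' where D': "D' \<subseteq> pverts (subdivide2 G) - ?D" "dominating_set (subdivide2 G) D'" by blast
  have "Orig v \<in> ?D" using assms by blast
  then have "Orig v \<in> pverts (subdivide2 G) - D'" using D' assms by auto
  then obtain y where "y \<in> D'" "(Orig v, y) \<in> parcs (subdivide2 G)"
    using D'(2) unfolding dominating_set_def by blast
  then show False using D'(1) by auto
qed

lemma card_star:
  "card (Orig ` pverts G \<union> (\<lambda>u. Sub v {v, u}) ` {u. (v, u) \<in> parcs G}) =
    card (pverts G) + card {u. (v, u) \<in> parcs G}"
proof -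
  have "finite {u. (v, u) \<in> parcs G}"
    by (rule finite_subset[OF _ pair_finite_verts]) (auto dest: in_arcsD2)
  moreover have "inj_on (\<lambda>u. Sub v {v, u}) {u. (v, u) \<in> parcs G}"
    by (auto simp: inj_on_def doubleton_eq_iff)
  ultimately show ?thesis
    using pair_finite_verts by (subst card_Un_disjoint) (auto simp: card_Orig card_image)
qed

section \<open>Neither a cycle nor \<open>K_2\<close>: permutations that cover all edges\<close>

lemma connected_closed_eq_verts:
  assumes "connected (with_proj G)" "v \<in> S" "S \<subseteq> pverts G"
    and closed: "\<And>u w. u \<in> S \<Longrightarrow> (u, w) \<in> parcs G \<Longrightarrow> w \<in> S"
  shows "S = pverts G"
proof -
  have sc: "strongly_connected (with_proj G)"
    using symmetric_connected_imp_strongly_connected[OF _ assms(1)] pair_sym_arcs by blast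
  have "w \<in> S" if "w \<in> pverts G" for w
  proof -
    have "v \<rightarrow>\<^sup>*\<^bsub>with_proj G\<^esub> w" using sc that assms(2,3) by (auto simp: strongly_connected_def)
    then show ?thesis by (induction rule: reachable_induct) (use assms(2) closed in auto)
  qed
  then show ?thesis using assms(3) by blast
qed

text \<open>Since every edge follows \<open>g\<close> in one direction, an orbit of \<open>g\<close>
  is closed under adjacency and by connectedness is everything. So \<open>g\<close> is one cyclic
  permutation. Absence of loops and \<open>gg\<close> exclude lengths 1 and 2.\<close>

lemma cyclic_enum_of_bij:
  assumes conn: "connected (with_proj G)"
    and g: "bij_betw g (pverts G) (pverts G)"
    and arc: "\<And>v. v \<in> pverts G \<Longrightarrow> (v, g v) \<in> parcs G"
    and arcs: "\<And>v u. (v, u) \<in> parcs G \<Longrightarrow> u = g v \<or> v = g u"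
    and gg: "\<And>v. v \<in> pverts G \<Longrightarrow> g (g v) \<noteq> v"
  shows "\<exists>n\<ge>3. \<exists>p. cyclic_enum G n p"
proof -
  obtain v where v: "v \<in> pverts G"
    using conn by (auto simp: connected_def strongly_connected_def)
  define p where "p i = (g ^^ i) v" for i
  have p_Suc: "p (Suc i) = g (p i)" for i by (simp add: p_def)
  have gV: "g w \<in> pverts G" if "w \<in> pverts G" for w using g that by (auto simp: bij_betw_def)
  have pV: "p i \<in> pverts G" for i
    by (induction i) (use v gV in \<open>auto simp: p_Suc, simp add: p_def\<close>)
  have ginj: "w = w'" if "g w = g w'" "w \<in> pverts G" "w' \<in> pverts G" for w w'
    using g that by (auto simp: bij_betw_def dest: inj_onD)
  \<comment> \<open>An injection of a finite set into itself is onto, so \<open>S\<close> is also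
    closed under preimages of \<open>g\<close>, hence under adjacency.\<close>
  have closed: "S = pverts G" if S: "S \<subseteq> pverts G" "w \<in> S" "g ` S \<subseteq> S" for S w
  proof (rule connected_closed_eq_verts[OF conn S(2,1)])
    have "finite S" using S(1) pair_finite_verts by (rule finite_subset)
    moreover have "inj_on g S" using S(1) by (auto intro!: inj_onI ginj)
    ultimately have gS: "g ` S = S" using endo_inj_surj S(3) by blast
    fix u x assume ux: "u \<in> S" "(u, x) \<in> parcs G"
    from arcs[OF ux(2)] show "x \<in> S"
    proof
      assume "u = g x"
      moreover obtain y where "y \<in> S" "u = g y" using gS ux(1) by blast
      moreover have "x \<in> pverts G" using ux(2) by (rule in_arcsD2)
      ultimately show ?thesis using ginj S(1) by blast
    qed (use gS ux in blast)
  qed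
  define n where "n = card (pverts G)"
  have inj: "inj_on p {..<n}"
  proof (rule ccontr)
    assume "\<not> inj_on p {..<n}"
    then obtain i j where ij: "i < j" "j < n" "p i = p j"
      by (auto simp: inj_on_def) (metis linorder_neqE_nat)
    \<comment> \<open>A repetition before step \<open>n\<close> would make the first
      \<open>j\<close> terms a closed set of fewer than \<open>n\<close> vertices.\<close>
    have "g ` p ` {..<j} \<subseteq> p ` {..<j}"
    proof clarify
      fix k assume "k < j"
      then have "Suc k < j \<or> Suc k = j" by linarith
      then show "g (p k) \<in> p ` {..<j}"
        unfolding p_Suc[symmetric] using ij by (metis image_eqI lessThan_iff)
    qed
    then have "p ` {..<j} = pverts G"
      using pV ij(1) by (intro closed[of _ "p i"]) auto
    then have "n \<le> j" using card_image_le[of "{..<j}" p] by (simp add: n_def)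
    then show False using ij(2) by simp
  qed
  have im: "p ` {..<n} = pverts G"
    using pV card_image[OF inj] by (intro card_subset_eq pair_finite_verts) (auto simp: n_def)
  have "n \<noteq> 0" using v pair_finite_verts by (auto simp: n_def)
  then obtain m where m: "n = Suc m" by (cases n) auto
  have pn: "p n = p 0"
  proof -
    obtain j where j: "j < n" "p n = p j" using pV[of n] im by (metis imageE lessThan_iff)
    show ?thesis
    proof (cases j)
      case (Suc k)
      then have "p m = p k" using ginj[OF _ pV pV] j(2) m by (simp add: p_Suc)
      then have "m = k" using inj j(1) Suc m by (auto dest: inj_onD)
      then show ?thesis using Suc j m by simp
    qed (use j in simp)
  qed
  have per: "p (i + n) = p i" for i
    by (induction i) (simp_all add: pn p_Suc)
  have "parcs G = (\<Union>i. {(p i, p (Suc i)), (p (Suc i), p i)})" (is "_ = ?R")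
  proof
    show "?R \<subseteq> parcs G" using arc[OF pV] arc_sym by (auto simp: p_Suc)
    show "parcs G \<subseteq> ?R"
    proof clarify
      fix u w assume uw: "(u, w) \<in> parcs G"
      obtain i j where "u = p i" "w = p j"
        using im in_arcsD1[OF uw] in_arcsD2[OF uw] by blast
      then show "(u, w) \<in> ?R" using arcs[OF uw] by (auto simp: p_Suc)
    qed
  qed
  then have p: "cyclic_enum G n p"
    using inj im per by (simp add: cyclic_enum_def bij_betw_def)
  have "n \<noteq> 1"
    using per[of 0] arc[OF v] pair_no_loops by (fastforce simp: p_def)
  moreover have "n \<noteq> 2"
    using per[of 0] gg[OF v] by (auto simp: p_def numeral_2_eq_2)
  ultimately have "n \<ge> 3" using m by linarith
  then show ?thesis using p by blast
qed

text \<open>The witness takes the subdivision vertex next to each leaf and every other original vertex.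
  A minimum dominating set in its complement picks a neighbour \<open>g v\<close> for every non-leaf \<open>v\<close>, and
  domination forces \<open>g\<close> to hit every vertex. Hence there are no leaves, \<open>g\<close> is a permutation, and
  each edge joins some \<open>v\<close> to \<open>g v\<close>.\<close>

lemma accurate_or_cyclic:
  assumes conn: "connected (with_proj G)"
    and nK2: "\<not> K\<^bsub>2\<^esub> (with_proj G)"
  shows "(\<exists>D. accurate_dominating_set (subdivide2 G) D \<and> card D = card (pverts G)) \<or>
    (\<exists>n\<ge>3. \<exists>p. cyclic_enum G n p)"
proof -
  define leaf where "leaf v \<longleftrightarrow> (\<exists>u. {w. (v, w) \<in> parcs G} = {u})" for v
  have leaf_unique: "w = u" if "leaf v" "(v, u) \<in> parcs G" "(v, w) \<in> parcs G" for v u w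
    using that unfolding leaf_def by (metis mem_Collect_eq singletonD)
  \<comment> \<open>Two adjacent leaves form a component by themselves, so \<open>G\<close> would be
    \<open>K_2\<close>.\<close>
  have leaf_nbr: "\<not> leaf u" if "leaf v" and vu: "(v, u) \<in> parcs G" for v u
  proof
    assume u: "leaf u"
    have uv: "(u, v) \<in> parcs G" using vu by (rule arc_sym)
    have V: "{v, u} = pverts G"
      by (rule connected_closed_eq_verts[OF conn, of v])
        (use that u uv in_arcsD1[OF vu] in_arcsD2[OF vu] in \<open>auto dest: leaf_unique\<close>)
    have ne: "v \<noteq> u" using pair_no_loops[OF vu] by simp
    have "parcs G = {(x, y). (x, y) \<in> pverts G \<times> pverts G \<and> x \<noteq> y}"
    proof
      show "parcs G \<subseteq> {(x, y). (x, y) \<in> pverts G \<times> pverts G \<and> x \<noteq> y}"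
        by (auto dest: in_arcsD1 in_arcsD2 pair_no_loops)
      show "{(x, y). (x, y) \<in> pverts G \<times> pverts G \<and> x \<noteq> y} \<subseteq> parcs G"
        unfolding V[symmetric] using vu uv by auto
    qed
    moreover have "card (pverts G) = 2"
      unfolding V[symmetric] using ne by simp
    ultimately have "K\<^bsub>2\<^esub> (with_proj G)"
      using pair_finite_verts by (simp add: complete_digraph_pair_def)
    then show False using nK2 by simp
  qed
  \<comment> \<open>\<open>s v\<close> stays in the class of \<open>v\<close>, so its image has one
    vertex in each class and thus minimum size.\<close>
  define s where "s v = (if leaf v then Sub v {v, the_elem {w. (v, w) \<in> parcs G}} else Orig v)" for v
  have s_leaf: "s v = Sub v {v, u}" if "leaf v" "(v, u) \<in> parcs G" for v u
  proof -
    have "{w. (v, w) \<in> parcs G} = {u}" using that leaf_unique by blast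
    then show ?thesis using that by (simp add: s_def)
  qed
  have s_nonleaf: "s v = Orig v" if "\<not> leaf v" for v using that by (simp add: s_def)
  have leafE: "\<exists>u. (v, u) \<in> parcs G" if "leaf v" for v using that by (auto simp: leaf_def)
  have center_s: "center (s v) = v" for v by (simp add: s_def)
  have sV: "s v \<in> pverts (subdivide2 G)" if "v \<in> pverts G" for v
    using that leafE[of v] s_leaf[of v] s_nonleaf[of v] by (cases "leaf v") auto
  define D where "D = s ` pverts G"
  have leaf_D: "Sub v {v, u} \<in> D" if "leaf v" "(v, u) \<in> parcs G" for v u
    unfolding D_def using s_leaf[OF that] in_arcsD1[OF that(2)] by (metis imageI)
  have nonleaf_D: "Orig v \<in> D" if "\<not> leaf v" "v \<in> pverts G" for v
    unfolding D_def using s_nonleaf[OF that(1)] that(2) by (metis imageI)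
  have cardD: "card D = card (pverts G)"
    unfolding D_def by (rule card_image, rule inj_on_inverseI[of _ center], rule center_s)
  have dom: "dominating_set (subdivide2 G) D"
    unfolding dominating_set_def
  proof (intro conjI ballI)
    show "D \<subseteq> pverts (subdivide2 G)" using sV by (auto simp: D_def)
    fix x assume x: "x \<in> pverts (subdivide2 G) - D"
    show "\<exists>y\<in>D. (x, y) \<in> parcs (subdivide2 G)"
    proof (cases x)
      case (Orig v)
      then have v: "v \<in> pverts G" using x by simp
      then have "leaf v" using x Orig nonleaf_D by blast
      then show ?thesis
        using Orig leafE[of v] leaf_D by auto
    next
      case (Sub v e)
      then obtain u where vu: "(v, u) \<in> parcs G" and e: "e = {v, u}"
        using x arc_sym by auto
      have v: "v \<in> pverts G" using vu by (rule in_arcsD1)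
      then have "\<not> leaf v" using leaf_D[OF _ vu] x Sub e by blast
      then show ?thesis
        using Sub e vu v nonleaf_D by (intro bexI[of _ "Orig v"]) auto
    qed
  qed
  show ?thesis
  proof (cases "accurate_dominating_set (subdivide2 G) D")
    case True
    then show ?thesis using cardD by blast
  next
    case False
    then obtain D' where D': "D' \<subseteq> pverts (subdivide2 G) - D" "card D' = card (pverts G)"
      and dom': "dominating_set (subdivide2 G) D'"
      using dom cardD by (auto simp: accurate_dominating_set_def)
    have "finite D'" using D'(1) finite_subdivide2 by (meson finite_Diff finite_subset)
    then have inj: "inj_on center D'"
      using center_dominating_set[OF dom'] D'(2) by (simp add: eq_card_imp_inj_on)
    have unique: "x = y" if "x \<in> D'" "y \<in> D'" "center x = center y" for x y
      using inj that by (auto dest: inj_onD)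
    define g where "g v = (THE u. Sub v {v, u} \<in> D')" for v
    have g: "g v = u" if "Sub v {v, u} \<in> D'" for v u
      unfolding g_def
      by (rule the_equality, rule that) (use that unique in \<open>fastforce simp: doubleton_eq_iff\<close>)
    \<comment> \<open>The vertices whose class is represented in \<open>D'\<close> by a subdivision
      vertex. Only there does \<open>g\<close> carry information.\<close>
    define A where "A = {v. \<exists>u. (v, u) \<in> parcs G \<and> Sub v {v, u} \<in> D'}"
    have A: "(v, g v) \<in> parcs G" "Sub v {v, g v} \<in> D'" if "v \<in> A" for v
      using that g unfolding A_def by auto
    have AI: "w \<in> A \<and> g w = v" if "Sub w {w, v} \<in> D'" "(w, v) \<in> parcs G" for w v
      using that g unfolding A_def by auto
    \<comment> \<open>The closed neighbourhood of \<open>Sub v {v, u}\<close> consists of itself,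
      \<open>Orig v\<close> and \<open>Sub u {v, u}\<close>, which gives the three
      alternatives.\<close>
    have Sub_dom: "Orig v \<in> D' \<or> v \<in> A \<and> g v = u \<or> u \<in> A \<and> g u = v" if vu: "(v, u) \<in> parcs G" for v u
    proof -
      have "Sub v {v, u} \<in> pverts (subdivide2 G)" using vu by auto
      then have "Sub v {v, u} \<in> D' \<or> (\<exists>y\<in>D'. (Sub v {v, u}, y) \<in> parcs (subdivide2 G))"
        using dom' unfolding dominating_set_def by blast
      then consider "Sub v {v, u} \<in> D'" | "Orig v \<in> D'" | "Sub u {u, v} \<in> D'"
        by (auto simp: doubleton_eq_iff insert_commute)
      then show ?thesis using AI vu arc_sym[OF vu] by cases blast+
    qed
    have surj: "\<exists>w\<in>A. g w = v" if v: "v \<in> pverts G" for v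
    proof (cases "leaf v")
      case True
      then obtain u where vu: "(v, u) \<in> parcs G" using leafE by blast
      have uv: "(u, v) \<in> parcs G" using vu by (rule arc_sym)
      \<comment> \<open>\<open>D\<close> occupies both \<open>Sub v {v, u}\<close> and
        \<open>Orig u\<close>, so only \<open>Sub u {v, u}\<close> itself can dominate
        \<open>Sub u {v, u}\<close>. Hence \<open>g u = v\<close>.\<close>
      have "Sub v {v, u} \<notin> D'" using leaf_D[OF True vu] D'(1) by blast
      moreover have "Orig u \<notin> D'"
        using nonleaf_D[OF leaf_nbr[OF True vu] in_arcsD2[OF vu]] D'(1) by blast
      ultimately show ?thesis using Sub_dom[OF uv] A(2)[of v] by auto
    next
      case False
      then have "Orig v \<in> D" using v nonleaf_D by blast
      then have nv: "Orig v \<notin> D'" using D'(1) by blast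
      have "Orig v \<in> pverts (subdivide2 G)" using v by simp
      then have "\<exists>y\<in>D'. (Orig v, y) \<in> parcs (subdivide2 G)"
        using nv dom' unfolding dominating_set_def by blast
      then obtain x where "(v, x) \<in> parcs G" by auto
      \<comment> \<open>A non-leaf has a neighbour other than \<open>g v\<close>. The subdivision
        vertex towards it is dominated neither by \<open>Orig v\<close> nor by itself, so
        \<open>g y = v\<close>.\<close>
      then obtain y where "(v, y) \<in> parcs G" "y \<noteq> g v"
        using False unfolding leaf_def by blast
      then show ?thesis using Sub_dom nv by blast
    qed
    have AV: "A \<subseteq> pverts G" using A(1) in_arcsD1 by blast
    have finA: "finite A" using AV pair_finite_verts by (rule finite_subset)
    have gA: "g ` A = pverts G" using surj A(1) in_arcsD2 by blast
    \<comment> \<open>A surjection from a subset \<open>A\<close> onto all vertices forces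
      \<open>A\<close> to be everything and \<open>g\<close> to be a permutation.\<close>
    have "card (pverts G) \<le> card A" using gA card_image_le[OF finA, of g] by simp
    then have AV': "A = pverts G" using AV pair_finite_verts by (metis card_seteq)
    have "inj_on g A" using finA gA AV' by (simp add: eq_card_imp_inj_on)
    then have bij: "bij_betw g (pverts G) (pverts G)" using gA AV' by (simp add: bij_betw_def)
    have nOrig: "Orig v \<notin> D'" if "v \<in> pverts G" for v
      using unique[of "Orig v" "Sub v {v, g v}"] A(2)[of v] that AV' by auto
    have arcs: "u = g v \<or> v = g u" if "(v, u) \<in> parcs G" for v u
      using Sub_dom[OF that] nOrig[OF in_arcsD1[OF that]] by blast
    have gg: "g (g v) \<noteq> v" if v: "v \<in> pverts G" for v
    proof
      assume ggv: "g (g v) = v"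
      have gv: "(v, g v) \<in> parcs G" using A(1) v AV' by blast
      \<comment> \<open>A 2-cycle of \<open>g\<close> would make \<open>v\<close> a leaf, whose
        subdivision vertex belongs to \<open>D\<close> and so cannot be in
        \<open>D'\<close>.\<close>
      have "w = g v" if "(v, w) \<in> parcs G" for w
        using arcs[OF that] ggv bij in_arcsD2[OF that] in_arcsD2[OF gv]
        by (auto simp: bij_betw_def dest: inj_onD)
      then have "leaf v" unfolding leaf_def using gv by blast
      then have "Sub v {v, g v} \<in> D" using leaf_D[OF _ gv] by blast
      then show False using A(2) D'(1) v AV' by blast
    qed
    show ?thesis
      using cyclic_enum_of_bij[OF conn bij _ arcs gg] A(1) AV' by blast
  qed
qed

section \<open>The exact values\<close>

lemma accurate_card_ge:
  "accurate_dominating_set (subdivide2 G) D \<Longrightarrow> card (pverts G) \<le> card D"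
  using card_dominating_set_ge by (auto simp: accurate_dominating_set_def)

lemma accurate_domination_number_cycle:
  assumes p: "cyclic_enum G n p" and n: "n \<ge> 3"
  shows "accurate_domination_number (subdivide2 G) = n + 2"
proof -
  have n0: "n > 0" using n by simp
  have cardV: "card (pverts G) = n" using p by (rule cyclic_enum_card)
  have parcs: "parcs G = (\<Union>i. {(p i, p (Suc i)), (p (Suc i), p i)})"
    using p by (simp add: cyclic_enum_def)
  \<comment> \<open>The star is taken at \<open>p 1\<close> so that both neighbours,
    \<open>p 0\<close> and \<open>p 2\<close>, have nonnegative indices.\<close>
  define D where "D = Orig ` pverts G \<union> (\<lambda>u. Sub (p 1) {p 1, u}) ` {u. (p 1, u) \<in> parcs G}"
  have "{u. (p 1, u) \<in> parcs G} = {p 0, p 2}"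
    unfolding parcs using cyclic_enum_Suc_eq_iff[OF p n0, of 0] cyclic_enum_Suc_eq_iff[OF p n0]
    by (auto simp: numeral_2_eq_2)
  moreover have "p 0 \<noteq> p 2" using n cyclic_enum_eq_iff[OF p n0, of 0 2] by simp
  ultimately have cardD: "card D = n + 2"
    unfolding D_def card_star using cardV by simp
  have accD: "accurate_dominating_set (subdivide2 G) D"
    unfolding D_def using cyclic_enum_range[OF p n0] by (intro accurate_star) blast
  have ge: "card D \<le> card D'" if acc: "accurate_dominating_set (subdivide2 G) D'" for D'
  proof (rule ccontr)
    assume "\<not> card D \<le> card D'"
    moreover obtain q where "cyclic_enum (subdivide2 G) (3 * n) q"
      using cyclic_enum_subdivide2[OF p n] by blast
    ultimately show False
      using cyclic_enum_not_accurate[of "subdivide2 G" n q D'] acc accurate_card_ge[OF acc] cardV n cardD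
      by simp
  qed
  show ?thesis
    unfolding accurate_domination_number_def
    using LEAST_card_eqI[of "accurate_dominating_set (subdivide2 G)", OF accD ge] cardD by simp
qed

text \<open>In the path \<open>S\<^sub>2(K\<^sub>2)\<close> the complement of a two-element dominating set is dominating.\<close>

lemma accurate_domination_number_K2:
  assumes K2: "K\<^bsub>2\<^esub> (with_proj G)"
  shows "accurate_domination_number (subdivide2 G) = 3"
proof -
  have card2: "card (pverts G) = 2" using K2 by (simp add: complete_digraph_pair_def)
  then obtain a b where V: "pverts G = {a, b}" and ne: "a \<noteq> b" by (auto simp: card_2_iff)
  have parcs: "parcs G = {(a, b), (b, a)}"
    using K2 V ne by (auto simp: complete_digraph_pair_def)
  define e where "e = {a, b}"
  have ba: "{b, a} = e" by (auto simp: e_def)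
  have SV: "pverts (subdivide2 G) = {Orig a, Orig b, Sub a e, Sub b e}"
    using ba by (auto simp: subdivide2_def V parcs e_def)
  have SE: "parcs (subdivide2 G) = {(Orig a, Sub a e), (Sub a e, Orig a), (Sub a e, Sub b e),
      (Orig b, Sub b e), (Sub b e, Orig b), (Sub b e, Sub a e)}"
    using ba by (auto simp: subdivide2_def V parcs e_def)
  define D where "D = Orig ` pverts G \<union> (\<lambda>u. Sub a {a, u}) ` {u. (a, u) \<in> parcs G}"
  have "{u. (a, u) \<in> parcs G} = {b}" using ne by (auto simp: parcs)
  then have cardD: "card D = 3"
    unfolding D_def card_star using card2 by simp
  have accD: "accurate_dominating_set (subdivide2 G) D"
    unfolding D_def using V by (intro accurate_star) blast
  have ge: "card D \<le> card D'" if acc: "accurate_dominating_set (subdivide2 G) D'" for D'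
  proof (rule ccontr)
    assume "\<not> card D \<le> card D'"
    then have c2: "card D' = 2" using accurate_card_ge[OF acc] card2 cardD by linarith
    have sub: "D' \<subseteq> pverts (subdivide2 G)" and dom: "dominating_set (subdivide2 G) D'"
      using acc by (auto simp: accurate_dominating_set_def dominating_set_def)
    have "finite D'" using sub finite_subdivide2 by (rule finite_subset)
    then have inj: "inj_on center D'"
      using center_dominating_set[OF dom] card2 c2 by (simp add: eq_card_imp_inj_on)
    \<comment> \<open>With two elements, \<open>D'\<close> takes exactly one vertex from each of the
      two classes \<open>{Orig v, Sub v e}\<close>. So does its complement, and the two vertices of
      a class are adjacent.\<close>
    have nboth: "\<not> (Orig v \<in> D' \<and> Sub v e \<in> D')" for v
      using inj_onD[OF inj, of "Orig v" "Sub v e"] by auto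
    have "dominating_set (subdivide2 G) (pverts (subdivide2 G) - D')"
      using nboth[of a] nboth[of b] by (auto simp: dominating_set_def SV SE)
    moreover have "card (pverts (subdivide2 G) - D') = card D'"
      using ne sub c2 \<open>finite D'\<close> by (simp add: card_Diff_subset) (simp add: SV)
    ultimately show False using acc by (auto simp: accurate_dominating_set_def)
  qed
  show ?thesis
    unfolding accurate_domination_number_def
    using LEAST_card_eqI[of "accurate_dominating_set (subdivide2 G)", OF accD ge] cardD by simp
qed

lemma accurate_domination_number_other:
  assumes "connected (with_proj G)" "\<not> is_cycle_graph G" "\<not> K\<^bsub>2\<^esub> (with_proj G)"
  shows "accurate_domination_number (subdivide2 G) = card (pverts G)"
proof -
  obtain D where D: "accurate_dominating_set (subdivide2 G) D" "card D = card (pverts G)"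
    using accurate_or_cyclic assms is_cycle_graph_iff_cyclic_enum[OF pair_graph_axioms] by blast
  then show ?thesis
    unfolding accurate_domination_number_def
    using LEAST_card_eqI[of "accurate_dominating_set (subdivide2 G)", OF D(1)] accurate_card_ge by simp
qed

end

theorem theorem4:
  fixes G :: "'a pair_pre_digraph"
  assumes "pair_graph G" and "connected (with_proj G)"
  shows "domination_number (subdivide2 G) = card (pverts G)
    \<and> (card (pverts G) \<le> accurate_domination_number (subdivide2 G)
       \<and> accurate_domination_number (subdivide2 G) \<le> card (pverts G) + 2)
    \<and> (is_cycle_graph G
         \<longrightarrow> accurate_domination_number (subdivide2 G) = card (pverts G) + 2)
    \<and> (K\<^bsub>2\<^esub> (with_proj G)
         \<longrightarrow> accurate_domination_number (subdivide2 G) = card (pverts G) + 1)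
    \<and> (\<not> is_cycle_graph G \<and> \<not> K\<^bsub>2\<^esub> (with_proj G)
         \<longrightarrow> accurate_domination_number (subdivide2 G) = card (pverts G))"
proof -
  interpret pair_graph G by fact
  have cycle: "accurate_domination_number (subdivide2 G) = card (pverts G) + 2" if "is_cycle_graph G"
  proof -
    obtain n p where "n \<ge> 3" "cyclic_enum G n p"
      using \<open>is_cycle_graph G\<close> is_cycle_graph_iff_cyclic_enum[OF assms(1)] by blast
    then show ?thesis using accurate_domination_number_cycle cyclic_enum_card by metis
  qed
  have K2: "accurate_domination_number (subdivide2 G) = card (pverts G) + 1" if "K\<^bsub>2\<^esub> (with_proj G)"
    using accurate_domination_number_K2[OF that] that by (simp add: complete_digraph_pair_def)
  \<comment> \<open>The general bounds are read off from the three exact values. A cycle that is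
    also \<open>K_2\<close> is excluded because the two values would disagree.\<close>
  show ?thesis
    using domination_number_subdivide2 cycle K2 accurate_domination_number_other[OF assms(2)]
    by (cases "is_cycle_graph G"; cases "K\<^bsub>2\<^esub> (with_proj G)") simp_all
qed

end
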